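(* Let $\mathbf X^{(1)},\mathbf X^{(2)},\dots$ be independent random points, each uniformly distributed in $(0,1)^2$. Let $K_n=-1$ if $\mathbf X^{(n)}$ does not set a record, and otherwise let $K_n$ be the number of current records at time $n-1$ broken by $\mathbf X^{(n)}$. Let $H_n=\sum_{i=1}^n i^{-1}$ and $\alpha_{n,k}:=-(k-1)2^{-(k+2)}H_n^{-1}$. Then for all integers $n\ge 1$ and $k\ge 0$, $$\left|\mathbb P(K_n=k\mid K_n\ge 0)-\Big[2^{-(k+1)}+\alpha_{n,k}\Big]\right|\le \tfrac12 n^{-1}H_n^{-1}.$$
   Context: For $x=(x_1,x_2)$ and $y=(y_1,y_2)$ in $\mathbb R^2$, write $x\prec y$ if $x_1<y_1$ and $x_2<y_2$; $x\succ y$ means $y\prec x$. The observation $\mathbf X^{(n)}$ is a (Pareto) record, or sets a record at time $n$, if $\mathbf X^{(n)}\not\succ \mathbf X^{(i)}$ for all $1\le i<n$. For $1\le j\le n$, $\mathbf X^{(j)}$ is a current record (or remaining record) at time $n$ if $\mathbf X^{(j)}\not\succ\mathbf X^{(i)}$ for all $i\in\{1,\dots,n\}$. $\mathbf X^{(n)}$ breaks (kills) $k$ records if $\mathbf X^{(n)}$ sets a record and there are precisely $k$ values $j$ with $1\le j<n$ such that $\mathbf X^{(j)}$ is a current record at time $n-1$ but not at time $n$. *)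

theory Defs
  imports "HOL-Probability.Probability"
begin

definition pareto_less :: "real \<times> real \<Rightarrow> real \<times> real \<Rightarrow> bool" where
  "pareto_less x y \<longleftrightarrow> fst x < fst y \<and> snd x < snd y"

text \<open>
  Observations are indexed by the positive integers; \<open>x 0\<close> is never used.
  Records are minima, not maxima.
\<close>

definition sets_record :: "(nat \<Rightarrow> real \<times> real) \<Rightarrow> nat \<Rightarrow> bool" where
  "sets_record x n \<longleftrightarrow> (\<forall>i. 1 \<le> i \<and> i < n \<longrightarrow> \<not> pareto_less (x i) (x n))"

definition current_record :: "(nat \<Rightarrow> real \<times> real) \<Rightarrow> nat \<Rightarrow> nat \<Rightarrow> bool" where
  "current_record x n j \<longleftrightarrow> j \<in> {1..n} \<and> (\<forall>i\<in>{1..n}. \<not> pareto_less (x i) (x j))"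

definition broken_records :: "(nat \<Rightarrow> real \<times> real) \<Rightarrow> nat \<Rightarrow> nat set" where
  "broken_records x n =
    {j. 1 \<le> j \<and> j < n \<and> current_record x (n - 1) j \<and> \<not> current_record x n j}"

definition K :: "(nat \<Rightarrow> real \<times> real) \<Rightarrow> nat \<Rightarrow> int" where
  "K x n = (if sets_record x n then int (card (broken_records x n)) else -1)"

definition alpha :: "nat \<Rightarrow> nat \<Rightarrow> real" where
  "alpha n k = - (real k - 1) * (1 / 2 ^ (k + 2)) * inverse (harm n)"

end

theory Submission
  imports Defs
begin

text \<open>
  Sort the points by their first coordinate. The second coordinates, read in this order, are again
  an i.i.d. sequence \<open>v 1, v 2, \<dots>\<close>, and the last observation sits at a uniformly distributed
  position \<open>p \<in> {1..n}\<close>. It is a record iff \<open>v p\<close> is the minimum of \<open>v 1, \<dots>, v p\<close>, which has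
  probability \<open>1 / p\<close>. The records that it breaks are the later positions \<open>i\<close> with \<open>v p < v i\<close> and
  \<open>v i\<close> below every other earlier value: the values which would be a new minimum if \<open>v p\<close> were
  deleted. As soon as a value below \<open>v p\<close> appears no further record can be broken. Hence, scanning
  \<open>v (p + 1), \<dots>, v n\<close> while \<open>v p\<close> is still the minimum, only the relative rank of the new value
  matters: rank 1 ends the process and rank 2 breaks one more record. By \<open>prob_rank_in\<close>
  the rank of \<open>v (m + 1)\<close> among \<open>v 1, \<dots>, v (m + 1)\<close> is uniform and independent of the order of
  \<open>v 1, \<dots>, v m\<close>, so both have probability \<open>1 / (m + 1)\<close>.

  Sum over the position \<open>p\<close>. Let \<open>a m k\<close> (\<open>min_sum\<close>) be the probability that the minimum of
  \<open>v 1, \<dots>, v m\<close> has broken exactly \<open>k\<close> records, and let \<open>f m k\<close> (\<open>record_sum\<close>) be the sum over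
  \<open>p \<le> m\<close> of the probabilities that \<open>v p\<close> is a record which has broken exactly \<open>k\<close> records. With
  \<open>a m (-1) = 1\<close>,
    \<open>a (m + 1) k = a m k + (a m (k - 1) - 2 * a m k) / (m + 1)\<close>,
    \<open>f (m + 1) k = f m k + (a m (k - 1) - a m k) / (m + 1)\<close>.
  Then \<open>P(K = k) = f n k / n\<close> and \<open>P(K \<ge> 0) = H n / n\<close>, so that the conditional probability is
  \<open>f n k / H n\<close>, and the claim is that \<open>f n k\<close> is within \<open>1 / (2 n)\<close> of
  \<open>H n / 2^(k + 1) - (k - 1) / 2^(k + 2)\<close>.

  In the following \<open>e m (-1) = d m (-1) = 0\<close>. The deviation \<open>e m k = a m k - 1 / 2^(k + 1)\<close> (\<open>min_dev\<close>) satisfies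
  \<open>(m + 1) e (m + 1) k = (m - 1) e m k + e m (k - 1)\<close>, so \<open>\<bar>e m k\<bar> \<le> 1 / (2 m)\<close> is preserved by induction.
  The error \<open>r\<close> of \<open>f\<close> splits as \<open>r = d + e\<close>, where \<open>d\<close> (\<open>dead_dev\<close>) comes from the records that are no longer the
  minimum, and the two recurrences combine to the exact relation \<open>2 * d m k = d m (k - 1) - e m k\<close>
  between consecutive values of \<open>k\<close> (\<open>dead_dev_recurrence\<close>). It gives \<open>\<bar>d m k\<bar> \<le> 1 / (2 m)\<close> by induction on \<open>k\<close>, and then
  \<open>r = (d m (k - 1) + e m k) / 2\<close> gives the same bound for \<open>r\<close>.
\<close>

section \<open>Events determined by finitely many comparisons\<close>

text \<open>
  All measurability questions reduce to this: the events of interest depend on the points only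
  through a finite table of comparisons, so they are finite unions of events prescribing the table.
\<close>

lemma pred_of_finitely_many_preds:
  assumes "finite J" and q: "\<And>j. j \<in> J \<Longrightarrow> Measurable.pred M (q j)"
    and E: "\<And>x y. x \<in> space M \<Longrightarrow> y \<in> space M \<Longrightarrow> (\<And>j. j \<in> J \<Longrightarrow> q j x = q j y) \<Longrightarrow> E x = E y"
  shows "Measurable.pred M E"
proof -
  define T where "T = {S \<in> Pow J. \<exists>y\<in>space M. E y \<and> (\<forall>j\<in>J. q j y \<longleftrightarrow> j \<in> S)}"
  have "finite T" using \<open>finite J\<close> by (simp add: T_def)
  have "Measurable.pred M (\<lambda>x. \<exists>S\<in>T. \<forall>j\<in>J. q j x \<longleftrightarrow> j \<in> S)"
    using \<open>finite T\<close> \<open>finite J\<close> q by (intro pred_intros_finite pred_intros_logic) auto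
  moreover have "E x \<longleftrightarrow> (\<exists>S\<in>T. \<forall>j\<in>J. q j x \<longleftrightarrow> j \<in> S)" if "x \<in> space M" for x
  proof
    assume "E x"
    then show "\<exists>S\<in>T. \<forall>j\<in>J. q j x \<longleftrightarrow> j \<in> S"
      using that by (intro bexI[of _ "{j\<in>J. q j x}"]) (auto simp: T_def)
  next
    assume "\<exists>S\<in>T. \<forall>j\<in>J. q j x \<longleftrightarrow> j \<in> S"
    then obtain S y where "\<forall>j\<in>J. q j x \<longleftrightarrow> j \<in> S" "y \<in> space M" "E y" "\<forall>j\<in>J. q j y \<longleftrightarrow> j \<in> S"
      by (auto simp: T_def)
    then show "E x" using E[of x y] that by auto
  qed
  ultimately show ?thesis by (subst measurable_cong)
qed

definition same_order :: "'i set \<Rightarrow> ('i \<Rightarrow> real) \<Rightarrow> ('i \<Rightarrow> real) \<Rightarrow> bool" where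
  "same_order I v w \<longleftrightarrow> (\<forall>i\<in>I. \<forall>j\<in>I. v i < v j \<longleftrightarrow> w i < w j)"

definition order_determined :: "'i set \<Rightarrow> (('i \<Rightarrow> real) \<Rightarrow> bool) \<Rightarrow> bool" where
  "order_determined I E \<longleftrightarrow> (\<forall>v w. same_order I v w \<longrightarrow> E v = E w)"

lemma same_order_mono: "same_order J v w \<Longrightarrow> I \<subseteq> J \<Longrightarrow> same_order I v w"
  unfolding same_order_def by blast

lemma same_order_less: "same_order I v w \<Longrightarrow> i \<in> I \<Longrightarrow> j \<in> I \<Longrightarrow> v i < v j \<longleftrightarrow> w i < w j"
  unfolding same_order_def by blast

lemma order_determined_mono: "order_determined I E \<Longrightarrow> I \<subseteq> J \<Longrightarrow> order_determined J E"
  unfolding order_determined_def using same_order_mono by blast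

lemma order_determined_conj:
  "order_determined I E \<Longrightarrow> order_determined I F \<Longrightarrow> order_determined I (\<lambda>v. E v \<and> F v)"
  unfolding order_determined_def by metis

lemma order_determined_not: "order_determined I E \<Longrightarrow> order_determined I (\<lambda>v. \<not> E v)"
  unfolding order_determined_def by metis

lemma order_determined_True: "order_determined I (\<lambda>v. True)"
  unfolding order_determined_def by simp

section \<open>Ranks within a finite family\<close>

definition rank_in :: "'i set \<Rightarrow> ('i \<Rightarrow> real) \<Rightarrow> 'i \<Rightarrow> nat" where
  "rank_in J v a = card {i\<in>J. v i \<le> v a}"

lemma rank_in_less_iff:
  assumes "finite J" "x \<in> J" "y \<in> J"
  shows "rank_in J v x < rank_in J v y \<longleftrightarrow> v x < v y"
proof (cases "v x < v y")
  case True
  then have "{i\<in>J. v i \<le> v x} \<subset> {i\<in>J. v i \<le> v y}"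
    using assms by force
  then show ?thesis unfolding rank_in_def using True assms by (simp add: psubset_card_mono)
next
  case False
  then have "{i\<in>J. v i \<le> v y} \<subseteq> {i\<in>J. v i \<le> v x}"
    by force
  then have "rank_in J v y \<le> rank_in J v x" unfolding rank_in_def using assms by (intro card_mono) auto
  then show ?thesis using False by simp
qed

lemma rank_in_bounds:
  assumes "finite J" "x \<in> J"
  shows "1 \<le> rank_in J v x" "rank_in J v x \<le> card J"
proof -
  have "card {x} \<le> rank_in J v x" unfolding rank_in_def using assms by (intro card_mono) auto
  then show "1 \<le> rank_in J v x" by simp
  show "rank_in J v x \<le> card J" unfolding rank_in_def using assms by (intro card_mono) auto
qed

lemma rank_in_inj:
  assumes "finite J" "inj_on v J" 
  shows "inj_on (rank_in J v) J"
proof (rule inj_onI)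
  fix x y assume "x \<in> J" "y \<in> J" "rank_in J v x = rank_in J v y"
  then have "v x = v y" using rank_in_less_iff[of J x y v] rank_in_less_iff[of J y x v] assms(1) by fastforce
  then show "x = y" using \<open>inj_on v J\<close> \<open>x \<in> J\<close> \<open>y \<in> J\<close> by (auto dest: inj_onD)
qed

lemma bij_betw_rank_in:
  assumes "finite J" "inj_on v J"
  shows "bij_betw (rank_in J v) J {1..card J}"
proof -
  have "rank_in J v ` J \<subseteq> {1..card J}" using rank_in_bounds[OF assms(1)] by auto
  moreover have "card (rank_in J v ` J) = card J" using rank_in_inj[OF assms] by (rule card_image)
  ultimately have "rank_in J v ` J = {1..card J}" by (intro card_subset_eq) auto
  then show ?thesis using rank_in_inj[OF assms] by (simp add: bij_betw_def)
qed

lemma same_order_rank_in: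
  assumes "same_order J v w" "a \<in> J"
  shows "rank_in J v a = rank_in J w a"
proof -
  have "{i\<in>J. v i \<le> v a} = {i\<in>J. w i \<le> w a}"
    using assms by (auto simp: same_order_def not_less[symmetric])
  then show ?thesis by (simp add: rank_in_def)
qed

lemma order_determined_rank_in: "a \<in> J \<Longrightarrow> order_determined J (\<lambda>v. Q (rank_in J v a))"
  unfolding order_determined_def using same_order_rank_in by metis

lemma rank_in_comp:
  assumes "bij_betw s J J" "a \<in> J"
  shows "rank_in J (v \<circ> s) a = rank_in J v (s a)"
proof -
  have "bij_betw s {i\<in>J. v (s i) \<le> v (s a)} {i\<in>J. v i \<le> v (s a)}"
    using assms(1) unfolding bij_betw_def by (auto simp: inj_on_def)
  then show ?thesis unfolding rank_in_def using bij_betw_same_card by fastforce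
qed

section \<open>I.i.d. sequences with a continuous distribution\<close>

text \<open>
  The number of broken records depends on the order of the coordinates alone, so their common
  distribution enters only through the absence of ties.
\<close>

locale atomless_prob = prob_space N for N :: "real measure" +
  assumes sets_N [measurable_cong, simp]: "sets N = sets borel"
    and atomless: "emeasure N {x} = 0"
begin

abbreviation P :: "(nat \<Rightarrow> real) measure" where "P \<equiv> Pi\<^sub>M UNIV (\<lambda>_. N)"

sublocale P: product_prob_space "\<lambda>_::nat. N" UNIV
  by unfold_locales

lemma space_N [simp]: "space N = UNIV"
  using sets_eq_imp_space_eq[OF sets_N] by simp

lemma space_P [simp]: "space P = UNIV"
  by (simp add: space_PiM)

lemma order_determined_pred:
  assumes "finite I" "order_determined I E"
  shows "Measurable.pred P E"
proof (rule pred_of_finitely_many_preds[where J = "I \<times> I" and q = "\<lambda>(i, j) v. v i < v j"])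
  show "finite (I \<times> I)" using assms by simp
  show "Measurable.pred P ((\<lambda>(i, j) v. v i < v j) ij)" for ij
    by (cases ij) simp
  show "E v = E w" if "\<And>ij. ij \<in> I \<times> I \<Longrightarrow> (case ij of (i, j) \<Rightarrow> \<lambda>v. v i < v j) v = (case ij of (i, j) \<Rightarrow> \<lambda>v. v i < v j) w"
    for v w
  proof -
    have "same_order I v w" unfolding same_order_def using that by fastforce
    then show ?thesis using assms(2) by (auto simp: order_determined_def)
  qed
qed

lemma distr_permute:
  assumes "bij s"
  shows "distr P P (\<lambda>v. v \<circ> s) = P"
  using distr_PiM_reindex[of UNIV "\<lambda>_. N" s UNIV] assms
  by (simp add: bij_is_inj prob_space_axioms comp_def restrict_def)

lemma prob_permute:
  assumes "bij s" "Measurable.pred P E"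
  shows "P.prob {v. E (v \<circ> s)} = P.prob {v. E v}"
proof -
  have [measurable]: "(\<lambda>v. v \<circ> s) \<in> P \<rightarrow>\<^sub>M P"
    unfolding comp_def by (rule measurable_PiM_single') auto
  have "P.prob {v. E v} = measure (distr P P (\<lambda>v. v \<circ> s)) {v. E v}"
    by (simp add: distr_permute assms)
  also have "\<dots> = P.prob {v. E (v \<circ> s)}"
    using assms(2) by (subst measure_distr) (auto simp: vimage_def pred_def)
  finally show ?thesis by simp
qed

lemma AE_neq:
  assumes "i \<noteq> j"
  shows "AE v in P. v i \<noteq> v j"
proof -
  interpret NN: pair_prob_space N N by unfold_locales
  have law: "N \<Otimes>\<^sub>M N = distr P (N \<Otimes>\<^sub>M N) (\<lambda>v. (v i, v j))"
  proof (rule pair_measure_eqI)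
    fix A B assume AB [measurable]: "A \<in> sets N" "B \<in> sets N"
    have "emeasure (distr P (N \<Otimes>\<^sub>M N) (\<lambda>v. (v i, v j))) (A \<times> B) = 
      emeasure P {v\<in>space P. \<forall>l\<in>{i, j}. v l \<in> (if l = i then A else B)}"
      using assms AB by (subst emeasure_distr) (auto intro!: arg_cong[where f="emeasure P"] pair_measureI)
    also have "\<dots> = emeasure N A * emeasure N B"
      using assms AB by (subst P.emeasure_PiM_Collect) (auto simp: sets_N[symmetric] simp del: sets_N)
    finally show "emeasure N A * emeasure N B = emeasure (distr P (N \<Otimes>\<^sub>M N) (\<lambda>v. (v i, v j))) (A \<times> B)"
      by simp
  qed (auto intro: sigma_finite_measure_axioms)
  have "AE z in N \<Otimes>\<^sub>M N. fst z \<noteq> snd z"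
  proof -
    have diag [measurable]: "{z. fst z = snd z} \<in> sets (N \<Otimes>\<^sub>M N)"
    proof -
      have "{z \<in> space (N \<Otimes>\<^sub>M N). fst z = snd z} \<in> sets (N \<Otimes>\<^sub>M N)" by measurable
      then show ?thesis by (simp add: space_pair_measure)
    qed
    have "emeasure (N \<Otimes>\<^sub>M N) {z. fst z = snd z} = (\<integral>\<^sup>+ x. emeasure N (Pair x -` {z. fst z = snd z}) \<partial>N)"
      by (rule emeasure_pair_measure_alt) measurable
    also have "\<dots> = (\<integral>\<^sup>+ x. emeasure N {x} \<partial>N)"
      by (intro nn_integral_cong arg_cong[where f = "emeasure N"]) auto
    finally show ?thesis
      by (intro AE_I[of _ _ "{z. fst z = snd z}"]) (use diag in \<open>auto simp: atomless\<close>)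
  qed
  then have "AE z in distr P (N \<Otimes>\<^sub>M N) (\<lambda>v. (v i, v j)). fst z \<noteq> snd z"
    unfolding law[symmetric] .
  from AE_distrD[OF _ this] show ?thesis by simp
qed

lemma AE_inj_on:
  assumes "finite I"
  shows "AE v in P. inj_on v I"
proof -
  have "AE v in P. \<forall>i\<in>I. \<forall>j\<in>I. i \<noteq> j \<longrightarrow> v i \<noteq> v j"
    using assms AE_neq by (simp add: AE_finite_all)
  then show ?thesis by eventually_elim (auto simp: inj_on_def)
qed

text \<open>
  Ties have probability zero, so events need to be compared on tie-free sequences only.
\<close>

lemma prob_cong_inj:
  assumes "finite I" "order_determined I E" "order_determined I F"
    and "\<And>v. inj_on v I \<Longrightarrow> E v \<longleftrightarrow> F v"
  shows "P.prob {v. E v} = P.prob {v. F v}"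
proof (rule P.finite_measure_eq_AE)
  show "AE v in P. v \<in> {v. E v} \<longleftrightarrow> v \<in> {v. F v}"
    using AE_inj_on[OF assms(1)] by eventually_elim (use assms(4) in auto)
qed (use order_determined_pred[OF assms(1,2)] order_determined_pred[OF assms(1,3)] in \<open>auto simp: pred_def\<close>)

lemma prob_partition:
  assumes "finite I" "order_determined I E" "finite J"
    and F: "\<And>j. j \<in> J \<Longrightarrow> order_determined I (F j)"
    and ex1: "\<And>v. inj_on v I \<Longrightarrow> E v \<Longrightarrow> \<exists>!j. j \<in> J \<and> F j v"
  shows "P.prob {v. E v} = (\<Sum>j\<in>J. P.prob {v. E v \<and> F j v})"
proof -
  have "P.prob {v\<in>space P. E v} = (\<Sum>j\<in>J. P.prob {v\<in>space P. E v \<and> F j v})"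
  proof (rule P.prob_sum)
    show "AE v in P. (\<forall>j\<in>J. E v \<and> F j v \<longrightarrow> E v) \<and> (E v \<longrightarrow> (\<exists>!j\<in>J. E v \<and> F j v))"
      using AE_inj_on[OF assms(1)] by eventually_elim (use ex1 in auto)
    show "{v\<in>space P. E v} \<in> P.events"
      using order_determined_pred[OF assms(1,2)] by (simp add: pred_def)
    show "{v\<in>space P. E v \<and> F j v} \<in> P.events" if "j \<in> J" for j
      using order_determined_pred[OF assms(1) order_determined_conj[OF assms(2) F[OF that]]]
      by (simp add: pred_def)
  qed fact
  then show ?thesis by simp
qed

text \<open>
  Let \<open>j\<close> be the index whose rank is adjacent to that of \<open>b\<close>. Exchanging the values at \<open>b\<close> and \<open>j\<close>
  exchanges these two ranks and leaves the order of the values on \<open>I\<close> untouched, since no other value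
  lies between them. As the values are exchangeable, the adjacent ranks \<open>r\<close> and \<open>Suc r\<close> of \<open>b\<close> are equally
  likely on \<open>E\<close>.
\<close>

lemma prob_rank_in_Suc:
  assumes I: "finite I" "b \<notin> I" and E: "order_determined I E" and r: "1 \<le> r" "r \<le> card I"
  defines "J \<equiv> insert b I"
  shows "P.prob {v. E v \<and> rank_in J v b = r} = P.prob {v. E v \<and> rank_in J v b = Suc r}"
proof -
  have J: "finite J" "b \<in> J" "card J = Suc (card I)" using I by (auto simp: J_def)
  have IJ: "I \<subseteq> J" by (auto simp: J_def)
  have EJ: "order_determined J E" using E IJ by (rule order_determined_mono)
  have od: "order_determined J (\<lambda>v. E v \<and> rank_in J v b = q)" for q
    by (intro order_determined_conj EJ order_determined_rank_in J)
  have od2: "order_determined J (\<lambda>v. (E v \<and> rank_in J v b = q) \<and> rank_in J v j = q')" if "j \<in> I" for j q q'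
    using that IJ by (intro order_determined_conj od order_determined_rank_in) auto
  have part: "P.prob {v. E v \<and> rank_in J v b = q} = (\<Sum>j\<in>I. P.prob {v. (E v \<and> rank_in J v b = q) \<and> rank_in J v j = q'})"
    if qq: "q \<noteq> q'" "q' \<in> {1..card J}" for q q'
  proof (rule prob_partition[OF J(1) od I(1)])
    show "order_determined J (\<lambda>v. rank_in J v j = q')" if "j \<in> I" for j
      using that IJ by (intro order_determined_rank_in) auto
    fix v :: "nat \<Rightarrow> real" assume "inj_on v J" and v: "E v \<and> rank_in J v b = q"
    then have bij: "bij_betw (rank_in J v) J {1..card J}" using J by (intro bij_betw_rank_in)
    then obtain j where j: "j \<in> J" "rank_in J v j = q'" using qq(2) unfolding bij_betw_def by (metis imageE)
    then have "j \<in> I" using v qq(1) by (auto simp: J_def)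
    moreover have "i = j" if "i \<in> I" "rank_in J v i = q'" for i
      using bij that j IJ unfolding bij_betw_def inj_on_def by blast
    ultimately show "\<exists>!j. j \<in> I \<and> rank_in J v j = q'" using j by blast
  qed
  have swap: "P.prob {v. (E v \<and> rank_in J v b = r) \<and> rank_in J v j = Suc r} =
    P.prob {v. (E v \<and> rank_in J v b = Suc r) \<and> rank_in J v j = r}" if j: "j \<in> I" for j
  proof -
    define s where "s = Transposition.transpose j b"
    have s: "s j = b" "s b = j" "\<And>x. x \<noteq> j \<Longrightarrow> x \<noteq> b \<Longrightarrow> s x = x"
      by (simp_all add: s_def)
    have bs: "bij s" unfolding s_def by simp
    have bJ: "bij_betw s J J" unfolding s_def using j IJ J by (intro bij_betw_transpose_iff) auto
    have odj: "order_determined J (\<lambda>v. (E v \<and> rank_in J v b = r) \<and> rank_in J v j = Suc r)"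
      by (rule od2[OF j])
    have "P.prob {v. (E v \<and> rank_in J v b = r) \<and> rank_in J v j = Suc r} =
      P.prob {v. (E (v \<circ> s) \<and> rank_in J (v \<circ> s) b = r) \<and> rank_in J (v \<circ> s) j = Suc r}"
      by (rule prob_permute[OF bs order_determined_pred[OF J(1) odj], symmetric])
    also have "\<dots> = P.prob {v. (E v \<and> rank_in J v b = Suc r) \<and> rank_in J v j = r}"
    proof (rule prob_cong_inj[OF J(1) _ od2[OF j]])
      show "order_determined J (\<lambda>v. (E (v \<circ> s) \<and> rank_in J (v \<circ> s) b = r) \<and> rank_in J (v \<circ> s) j = Suc r)"
        unfolding order_determined_def
      proof (intro allI impI)
        fix v w :: "nat \<Rightarrow> real" assume "same_order J v w"
        then have "same_order J (v \<circ> s) (w \<circ> s)"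
          using bJ by (auto simp: same_order_def bij_betw_def)
        then show "((E (v \<circ> s) \<and> rank_in J (v \<circ> s) b = r) \<and> rank_in J (v \<circ> s) j = Suc r) =
          ((E (w \<circ> s) \<and> rank_in J (w \<circ> s) b = r) \<and> rank_in J (w \<circ> s) j = Suc r)"
          using odj by (auto simp: order_determined_def)
      qed
      fix v :: "nat \<Rightarrow> real" assume inj: "inj_on v J"
      have rks: "rank_in J (v \<circ> s) b = rank_in J v j" "rank_in J (v \<circ> s) j = rank_in J v b"
        using rank_in_comp[OF bJ] J j IJ s by auto
      have "same_order I (v \<circ> s) v" if h: "rank_in J v b = Suc r" "rank_in J v j = r"
      proof -
        have ne: "rank_in J v x \<noteq> r \<and> rank_in J v x \<noteq> Suc r" if "x \<in> I" "x \<noteq> j" for x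
          using rank_in_inj[OF J(1) inj] h that j IJ J I(2) unfolding inj_on_def by (metis subsetD)
        have less: "v x < v y \<longleftrightarrow> rank_in J v x < rank_in J v y" if "x \<in> J" "y \<in> J" for x y
          using rank_in_less_iff[OF J(1) that] by simp
        have "v (s x) < v (s y) \<longleftrightarrow> v x < v y" if xy: "x \<in> I" "y \<in> I" for x y
        proof -
          have xyb: "x \<noteq> b" "y \<noteq> b" "x \<in> J" "y \<in> J" "j \<in> J" using xy I j IJ by auto
          show ?thesis
            using ne[of x] ne[of y] xy xyb s h J(2)
            by (cases "x = j"; cases "y = j") (auto simp: less)
        qed
        then show ?thesis by (auto simp: same_order_def)
      qed
      then have "E (v \<circ> s) = E v" if "rank_in J v b = Suc r" "rank_in J v j = r"
        using that E by (auto simp: order_determined_def)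
      then show "(E (v \<circ> s) \<and> rank_in J (v \<circ> s) b = r) \<and> rank_in J (v \<circ> s) j = Suc r \<longleftrightarrow>
        (E v \<and> rank_in J v b = Suc r) \<and> rank_in J v j = r"
        unfolding rks by auto
    qed
    finally show ?thesis .
  qed
  have "P.prob {v. E v \<and> rank_in J v b = r} =
      (\<Sum>j\<in>I. P.prob {v. (E v \<and> rank_in J v b = r) \<and> rank_in J v j = Suc r})"
    using r J by (intro part) auto
  also have "\<dots> = (\<Sum>j\<in>I. P.prob {v. (E v \<and> rank_in J v b = Suc r) \<and> rank_in J v j = r})"
    by (intro sum.cong refl swap)
  also have "\<dots> = P.prob {v. E v \<and> rank_in J v b = Suc r}"
    using r J by (intro part[symmetric]) auto
  finally show ?thesis .
qed

text \<open>
  The rank of a new value is uniform and independent of the order of the old ones: by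
  \<open>prob_rank_in_Suc\<close> all ranks contribute equally to the probability of \<open>E\<close>.
\<close>

lemma prob_rank_in:
  assumes I: "finite I" "b \<notin> I" and E: "order_determined I E" and r: "1 \<le> r" "r \<le> Suc (card I)"
  shows "P.prob {v. E v \<and> rank_in (insert b I) v b = r} = P.prob {v. E v} / Suc (card I)"
proof -
  define G where "G q = P.prob {v. E v \<and> rank_in (insert b I) v b = q}" for q
  have G: "G q = G 1" if "q \<in> {1..Suc (card I)}" for q
  proof -
    have "1 \<le> q \<Longrightarrow> q \<le> Suc (card I) \<longrightarrow> G q = G 1"
    proof (induction q rule: dec_induct)
      case (step q)
      then show ?case using prob_rank_in_Suc[OF I E, of q] by (auto simp: G_def)
    qed simp
    then show ?thesis using that by auto
  qed
  have EJ: "order_determined (insert b I) E" using E by (rule order_determined_mono) auto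
  have "P.prob {v. E v} = (\<Sum>q\<in>{1..Suc (card I)}. P.prob {v. E v \<and> rank_in (insert b I) v b = q})"
  proof (rule prob_partition[OF _ EJ])
    fix v :: "nat \<Rightarrow> real"
    show "\<exists>!q. q \<in> {1..Suc (card I)} \<and> rank_in (insert b I) v b = q"
      using rank_in_bounds[of "insert b I" b v] I by auto
  qed (use I in \<open>auto intro: order_determined_rank_in\<close>)
  also have "\<dots> = (\<Sum>q\<in>{1..Suc (card I)}. G 1)"
    unfolding G_def[symmetric] by (intro sum.cong refl G)
  also have "\<dots> = Suc (card I) * G r" using G[of r] r by simp
  finally show ?thesis by (simp add: G_def)
qed

end

section \<open>Records and the records they break, in order of the first coordinate\<close>

text \<open>
  Here \<open>v\<close> lists the second coordinates in increasing order of the first coordinate. The value at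
  \<open>p\<close> is a record iff \<open>min_upto p p v\<close> holds; points further right cannot dominate it.
\<close>

definition min_upto :: "nat \<Rightarrow> nat \<Rightarrow> (nat \<Rightarrow> real) \<Rightarrow> bool" where
  "min_upto m p v \<longleftrightarrow> (\<forall>i\<in>{1..m} - {p}. v p < v i)"

text \<open>
  The records broken by the point at position \<open>p\<close>, when only the first \<open>m\<close> positions are present. Its
  removal from the competition (\<open>- {p}\<close>) expresses that the broken records were current before
  that point arrived.
\<close>

definition killed :: "nat \<Rightarrow> nat \<Rightarrow> (nat \<Rightarrow> real) \<Rightarrow> nat set" where
  "killed m p v = {i\<in>{p<..m}. v p < v i \<and> (\<forall>j\<in>{1..<i} - {p}. v i < v j)}"

lemma order_determined_min_upto:
  assumes "p \<in> {1..n}" "m \<le> n"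
  shows "order_determined {1..n} (min_upto m p)"
proof -
  have "min_upto m p v = min_upto m p w" if "same_order {1..n} v w" for v w
    using assms same_order_less[OF that] unfolding min_upto_def by auto
  then show ?thesis unfolding order_determined_def by metis
qed

lemma order_determined_killed:
  assumes "p \<in> {1..n}" "m \<le> n"
  shows "order_determined {1..n} (\<lambda>v. Q (killed m p v))"
proof -
  have "killed m p v = killed m p w" if "same_order {1..n} v w" for v w
    using assms same_order_less[OF that] unfolding killed_def
    by (intro Collect_cong conj_cong ball_cong refl) auto
  then show ?thesis unfolding order_determined_def by metis
qed

lemma min_upto_Suc:
  assumes "p \<in> {1..m}"
  shows "min_upto (Suc m) p v \<longleftrightarrow> min_upto m p v \<and> v p < v (Suc m)"
  using assms by (auto simp: min_upto_def le_Suc_eq)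

lemma killed_Suc:
  assumes "p \<in> {1..m}"
  shows "killed (Suc m) p v = killed m p v \<union>
    (if v p < v (Suc m) \<and> (\<forall>j\<in>{1..m} - {p}. v (Suc m) < v j) then {Suc m} else {})"
  using assms by (auto simp: killed_def le_Suc_eq less_Suc_eq_le)

lemma finite_killed [simp]: "finite (killed m p v)"
  unfolding killed_def by simp

lemma atLeastAtMost_insert_Suc: "{1..Suc m} = insert (Suc m) {1..m}"
  by auto

lemma rank_in_eq_1_iff:
  assumes "finite J" "a \<in> J" "inj_on v J"
  shows "rank_in J v a = 1 \<longleftrightarrow> (\<forall>i\<in>J - {a}. v a < v i)"
proof
  assume "rank_in J v a = 1"
  then have "card {i\<in>J. v i \<le> v a} = 1" by (simp add: rank_in_def)
  then obtain x where x: "{i\<in>J. v i \<le> v a} = {x}" by (metis card_1_singletonE)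
  have "a \<in> {i\<in>J. v i \<le> v a}" using assms(2) by simp
  then have "x = a" using x by simp
  then have "i \<in> J \<Longrightarrow> v i \<le> v a \<Longrightarrow> i = a" for i using x by blast
  then show "\<forall>i\<in>J - {a}. v a < v i" by (force simp: not_le[symmetric])
next
  assume "\<forall>i\<in>J - {a}. v a < v i"
  then have "i = a" if "i \<in> J" "v i \<le> v a" for i
    using that by (meson DiffI leD singletonD)
  then have "{i\<in>J. v i \<le> v a} = {a}" using assms(2) by auto
  then show "rank_in J v a = 1" by (simp add: rank_in_def)
qed

text \<open>
  While \<open>v p\<close> is the minimum, rank 1 of the next value ends its reign and rank 2 means that the next
  value beats everything except \<open>v p\<close>; these are the only two ranks with an effect.
\<close>

lemma rank_in_Suc_of_min:
  assumes p: "p \<in> {1..m}" and min: "min_upto m p v" and inj: "inj_on v {1..Suc m}"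
  shows "rank_in {1..Suc m} v (Suc m) = 1 \<longleftrightarrow> v (Suc m) < v p"
    and "rank_in {1..Suc m} v (Suc m) = 2 \<longleftrightarrow> v p < v (Suc m) \<and> (\<forall>j\<in>{1..m} - {p}. v (Suc m) < v j)"
proof -
  show first: "rank_in {1..Suc m} v (Suc m) = 1 \<longleftrightarrow> v (Suc m) < v p"
  proof (subst rank_in_eq_1_iff)
    have "v (Suc m) < v i" if "v (Suc m) < v p" "i \<in> {1..Suc m} - {Suc m}" for i
    proof (cases "i = p")
      case False
      then have "v p < v i" using that min by (auto simp: min_upto_def)
      then show ?thesis using that by simp
    qed (use that in simp)
    moreover have "p \<in> {1..Suc m} - {Suc m}" using p by auto
    ultimately show "(\<forall>i\<in>{1..Suc m} - {Suc m}. v (Suc m) < v i) = (v (Suc m) < v p)"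
      by blast
  qed (use inj in auto)
  have ne: "v j \<noteq> v (Suc m)" if "j \<in> {1..m}" for j
    using inj_onD[OF inj, of j "Suc m"] that by auto
  show "rank_in {1..Suc m} v (Suc m) = 2 \<longleftrightarrow> v p < v (Suc m) \<and> (\<forall>j\<in>{1..m} - {p}. v (Suc m) < v j)"
  proof
    assume v: "v p < v (Suc m) \<and> (\<forall>j\<in>{1..m} - {p}. v (Suc m) < v j)"
    have "i = p \<or> i = Suc m" if "i \<in> {1..Suc m}" "v i \<le> v (Suc m)" for i
    proof (rule ccontr)
      assume "\<not> (i = p \<or> i = Suc m)"
      then have "i \<in> {1..m} - {p}" using that(1) by auto
      then have "v (Suc m) < v i" using v by blast
      then show False using that(2) by simp
    qed
    then have "{i\<in>{1..Suc m}. v i \<le> v (Suc m)} = {p, Suc m}"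
      using p v by auto
    then show "rank_in {1..Suc m} v (Suc m) = 2" using p by (simp add: rank_in_def)
  next
    assume r: "rank_in {1..Suc m} v (Suc m) = 2"
    have "v p < v (Suc m)"
    proof (rule ccontr)
      assume "\<not> v p < v (Suc m)"
      then have "v (Suc m) < v p" using ne[OF p] by simp
      then show False using r first by simp
    qed
    moreover have "v (Suc m) < v j" if j: "j \<in> {1..m} - {p}" for j
    proof (rule ccontr)
      assume "\<not> v (Suc m) < v j"
      then have "card {p, Suc m, j} \<le> rank_in {1..Suc m} v (Suc m)"
        using p j \<open>v p < v (Suc m)\<close> unfolding rank_in_def by (intro card_mono) auto
      then show False using r p j by auto
    qed
    ultimately show "v p < v (Suc m) \<and> (\<forall>j\<in>{1..m} - {p}. v (Suc m) < v j)" by blast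
  qed
qed

text \<open>
  Once the value at \<open>p\<close> has been undercut, the undercutting point already dominates every later
  candidate, so the set of broken records is final.
\<close>

lemma killed_Suc_no_min:
  assumes "p \<in> {1..m}" "\<not> min_upto m p v" "inj_on v {1..Suc m}"
  shows "killed (Suc m) p v = killed m p v"
proof -
  obtain j where j: "j \<in> {1..m} - {p}" "v j \<le> v p"
    using assms(2) unfolding min_upto_def not_less[symmetric] by blast
  then have "\<not> (v p < v (Suc m) \<and> (\<forall>j\<in>{1..m} - {p}. v (Suc m) < v j))"
    by (meson leD less_trans)
  then show ?thesis using killed_Suc[OF assms(1), of v] by auto
qed

lemma card_killed_Suc:
  assumes "p \<in> {1..m}" "inj_on v {1..Suc m}"
  shows "card (killed (Suc m) p v) = card (killed m p v) +
    (if min_upto m p v \<and> rank_in {1..Suc m} v (Suc m) = 2 then 1 else 0)"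
proof (cases "min_upto m p v")
  case False
  then show ?thesis using killed_Suc_no_min[OF assms(1) _ assms(2)] by simp
next
  case True
  have "Suc m \<notin> killed m p v" by (simp add: killed_def)
  then show ?thesis
    using True killed_Suc[OF assms(1), of v] rank_in_Suc_of_min(2)[OF assms(1) True assms(2)] by auto
qed

lemma min_upto_Suc_rank_in:
  assumes "p \<in> {1..m}" "inj_on v {1..Suc m}"
  shows "min_upto (Suc m) p v \<longleftrightarrow> min_upto m p v \<and> rank_in {1..Suc m} v (Suc m) \<noteq> 1"
proof -
  have "v p \<noteq> v (Suc m)" using inj_onD[OF assms(2), of p "Suc m"] assms(1) by auto
  then show ?thesis
    using min_upto_Suc[OF assms(1), of v] rank_in_Suc_of_min(1)[OF assms(1) _ assms(2)] by auto
qed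

lemma min_upto_imp_record: "min_upto m p v \<Longrightarrow> p \<le> m \<Longrightarrow> min_upto p p v"
  by (auto simp: min_upto_def)

context atomless_prob
begin

section \<open>Recurrences for the probabilities\<close>

definition min_prob :: "nat \<Rightarrow> nat \<Rightarrow> nat \<Rightarrow> real" where
  "min_prob m p k = P.prob {v. min_upto m p v \<and> card (killed m p v) = k}"

definition record_prob :: "nat \<Rightarrow> nat \<Rightarrow> nat \<Rightarrow> real" where
  "record_prob m p k = P.prob {v. min_upto p p v \<and> card (killed m p v) = k}"

lemma prob_split:
  assumes "finite I" "order_determined I E" "order_determined I F"
  shows "P.prob {v. E v} = P.prob {v. E v \<and> F v} + P.prob {v. E v \<and> \<not> F v}"
proof -
  have *: "order_determined I (\<lambda>v. F v = b)" for b
    using assms(3) by (auto simp: order_determined_def)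
  have "P.prob {v. E v} = (\<Sum>b\<in>UNIV. P.prob {v. E v \<and> F v = b})"
    by (rule prob_partition[OF assms(1,2) _ *]) auto
  then show ?thesis by (simp add: UNIV_bool)
qed

context
  fixes m p :: nat
  assumes p: "p \<in> {1..m}"
begin

private abbreviation "R v \<equiv> rank_in {1..Suc m} v (Suc m)"
private abbreviation "C v \<equiv> card (killed m p v)"
private abbreviation "C' v \<equiv> card (killed (Suc m) p v)"

private lemma od:
  "order_determined {1..Suc m} (min_upto m p)"
  "order_determined {1..Suc m} (min_upto (Suc m) p)"
  "order_determined {1..Suc m} (min_upto p p)"
  "order_determined {1..Suc m} (\<lambda>v. C v = k)"
  "order_determined {1..Suc m} (\<lambda>v. Suc (C v) = k)"
  "order_determined {1..Suc m} (\<lambda>v. C' v = k)"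
  "order_determined {1..Suc m} (\<lambda>v. R v = k)"
  using p by (intro order_determined_min_upto order_determined_killed order_determined_rank_in; simp)+

private lemmas ods = order_determined_conj order_determined_not od

private lemma min_prob_rank_in:
  assumes "r \<in> {1..Suc m}"
  shows "P.prob {v. (min_upto m p v \<and> C v = k) \<and> R v = r} = min_prob m p k / Suc m"
proof -
  have "order_determined {1..m} (\<lambda>v. min_upto m p v \<and> C v = k)"
    using p by (intro order_determined_conj order_determined_min_upto order_determined_killed) auto
  then show ?thesis
    using prob_rank_in[of "{1..m}" "Suc m" "\<lambda>v. min_upto m p v \<and> C v = k" r] assms
    unfolding min_prob_def atLeastAtMost_insert_Suc[symmetric] by simp
qed

private lemma min_prob_rank_in_pred:
  "P.prob {v. (min_upto m p v \<and> Suc (C v) = k) \<and> R v = 2} =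
     (if k = 0 then 0 else min_prob m p (k - 1)) / Suc m"
  using min_prob_rank_in[of 2 "k - 1"] p by (cases k) simp_all

text \<open>
  The count of broken records moves from \<open>k\<close> to \<open>k + 1\<close> exactly when \<open>v p\<close> is still the minimum and the next
  value has rank 2. So \<open>record_prob\<close> loses the mass of these events with old count \<open>k\<close> and
  gains that with old count \<open>k - 1\<close>; the remaining part \<open>X\<close> is common to both sides.
\<close>

lemma record_prob_step:
  "record_prob (Suc m) p k = record_prob m p k +
     ((if k = 0 then 0 else min_prob m p (k - 1)) - min_prob m p k) / Suc m"
proof -
  define X where "X = P.prob {v. (min_upto p p v \<and> C v = k) \<and> \<not> (min_upto m p v \<and> R v = 2)}"
  have "record_prob m p k = P.prob {v. (min_upto p p v \<and> C v = k) \<and> (min_upto m p v \<and> R v = 2)} + X"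
    unfolding record_prob_def X_def by (intro prob_split[of "{1..Suc m}"] ods) auto
  also have "{v. (min_upto p p v \<and> C v = k) \<and> (min_upto m p v \<and> R v = 2)} =
      {v. (min_upto m p v \<and> C v = k) \<and> R v = 2}"
    using min_upto_imp_record p by auto
  finally have a: "record_prob m p k = min_prob m p k / Suc m + X"
    using min_prob_rank_in[of 2 k] p by simp
  have "record_prob (Suc m) p k = P.prob {v. (min_upto p p v \<and> C' v = k) \<and> (min_upto m p v \<and> R v = 2)}
    + P.prob {v. (min_upto p p v \<and> C' v = k) \<and> \<not> (min_upto m p v \<and> R v = 2)}"
    unfolding record_prob_def by (intro prob_split[of "{1..Suc m}"] ods) auto
  also have "P.prob {v. (min_upto p p v \<and> C' v = k) \<and> \<not> (min_upto m p v \<and> R v = 2)} = X"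
    unfolding X_def
    by (intro prob_cong_inj[of "{1..Suc m}"] ods) (use card_killed_Suc[OF p] in auto)
  also have "P.prob {v. (min_upto p p v \<and> C' v = k) \<and> (min_upto m p v \<and> R v = 2)} =
    P.prob {v. ((min_upto m p v \<and> Suc (C v) = k)) \<and> R v = 2}"
    by (intro prob_cong_inj[of "{1..Suc m}"] ods)
      (use card_killed_Suc[OF p] min_upto_imp_record p in auto)
  finally show ?thesis using a min_prob_rank_in_pred[of k] by (simp add: diff_divide_distrib)
qed

text \<open>
  As in \<open>record_prob_step\<close>, except that rank 1 now also removes mass, whence the factor 2.
\<close>

lemma min_prob_step:
  "min_prob (Suc m) p k = min_prob m p k +
     ((if k = 0 then 0 else min_prob m p (k - 1)) - 2 * min_prob m p k) / Suc m"
proof -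
  define X where "X = P.prob {v. ((min_upto m p v \<and> C v = k) \<and> \<not> R v = 2) \<and> \<not> R v = 1}"
  have "min_prob m p k = P.prob {v. (min_upto m p v \<and> C v = k) \<and> R v = 2} 
      + P.prob {v. (min_upto m p v \<and> C v = k) \<and> \<not> R v = 2}"
    unfolding min_prob_def by (intro prob_split[of "{1..Suc m}"] ods) auto
  also have "P.prob {v. (min_upto m p v \<and> C v = k) \<and> \<not> R v = 2} =
     P.prob {v. ((min_upto m p v \<and> C v = k) \<and> \<not> R v = 2) \<and> R v = 1} + X"
    unfolding X_def by (intro prob_split[of "{1..Suc m}"] ods) auto
  also have "{v. ((min_upto m p v \<and> C v = k) \<and> \<not> R v = 2) \<and> R v = 1} =
      {v. (min_upto m p v \<and> C v = k) \<and> R v = 1}"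
    by auto
  finally have a: "min_prob m p k = 2 * (min_prob m p k / Suc m) + X"
    using min_prob_rank_in[of 1 k] min_prob_rank_in[of 2 k] p by simp
  have "min_prob (Suc m) p k = P.prob {v. (min_upto (Suc m) p v \<and> C' v = k) \<and> R v = 2}
    + P.prob {v. (min_upto (Suc m) p v \<and> C' v = k) \<and> \<not> R v = 2}"
    unfolding min_prob_def by (intro prob_split[of "{1..Suc m}"] ods) auto
  also have "P.prob {v. (min_upto (Suc m) p v \<and> C' v = k) \<and> \<not> R v = 2} = X"
    unfolding X_def
    by (intro prob_cong_inj[of "{1..Suc m}"] ods)
      (use card_killed_Suc[OF p] min_upto_Suc_rank_in[OF p] in auto)
  also have "P.prob {v. (min_upto (Suc m) p v \<and> C' v = k) \<and> R v = 2} =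
    P.prob {v. ((min_upto m p v \<and> Suc (C v) = k)) \<and> R v = 2}"
    by (intro prob_cong_inj[of "{1..Suc m}"] ods)
      (use card_killed_Suc[OF p] min_upto_Suc_rank_in[OF p] in auto)
  finally show ?thesis using a min_prob_rank_in_pred[of k] by (simp add: diff_divide_distrib)
qed

end

lemma prob_min_upto:
  assumes "m \<ge> 1"
  shows "P.prob {v. min_upto m m v} = 1 / m"
proof -
  obtain l where l: "m = Suc l" using assms by (cases m) auto
  have "P.prob {v. min_upto m m v} = P.prob {v. True \<and> rank_in {1..m} v m = 1}"
  proof (rule prob_cong_inj[of "{1..m}"])
    show "min_upto m m v \<longleftrightarrow> True \<and> rank_in {1..m} v m = 1" if "inj_on v {1..m}" for v
      using rank_in_eq_1_iff[of "{1..m}" m v] that assms by (simp add: min_upto_def)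
    show "order_determined {1..m} (\<lambda>v. True \<and> rank_in {1..m} v m = 1)"
      using assms by (intro order_determined_conj order_determined_True order_determined_rank_in) auto
    show "order_determined {1..m} (min_upto m m)"
      using assms by (intro order_determined_min_upto) auto
  qed simp
  also have "\<dots> = P.prob {v. True} / Suc (card {1..l})"
    using prob_rank_in[OF _ _ order_determined_True, of "{1..l}" m 1]
    unfolding l atLeastAtMost_insert_Suc[symmetric] by simp
  also have "P.prob {v. True} = 1" using P.P.prob_space by simp
  finally show ?thesis using l by simp
qed

lemma killed_self: "killed m m v = {}"
  by (auto simp: killed_def)

lemma record_prob_self: "m \<ge> 1 \<Longrightarrow> record_prob m m k = (if k = 0 then 1 / m else 0)"
  and min_prob_self: "m \<ge> 1 \<Longrightarrow> min_prob m m k = (if k = 0 then 1 / m else 0)"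
  using prob_min_upto[of m] by (auto simp: record_prob_def min_prob_def killed_self)

definition min_sum :: "nat \<Rightarrow> nat \<Rightarrow> real" where
  "min_sum m k = (\<Sum>p=1..m. min_prob m p k)"

definition record_sum :: "nat \<Rightarrow> nat \<Rightarrow> real" where
  "record_sum m k = (\<Sum>p=1..m. record_prob m p k)"

lemma min_sum_0: "min_sum 0 k = 0" and record_sum_0: "record_sum 0 k = 0"
  by (simp_all add: min_sum_def record_sum_def)

text \<open>
  The new position \<open>Suc m\<close> is itself the minimum with probability \<open>1 / Suc m\<close> and then has broken
  nothing; this is the boundary value 1 at \<open>k = 0\<close>.
\<close>

lemma min_sum_Suc:
  "min_sum (Suc m) k = min_sum m k + ((if k = 0 then 1 else min_sum m (k - 1)) - 2 * min_sum m k) / Suc m"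
proof -
  have "min_sum (Suc m) k = (\<Sum>p=1..m. min_prob (Suc m) p k) + min_prob (Suc m) (Suc m) k"
    by (simp add: min_sum_def)
  also have "(\<Sum>p=1..m. min_prob (Suc m) p k) = (\<Sum>p=1..m. min_prob m p k +
     ((if k = 0 then 0 else min_prob m p (k - 1)) - 2 * min_prob m p k) / Suc m)"
    by (intro sum.cong refl min_prob_step)
  also have "\<dots> = min_sum m k + ((if k = 0 then 0 else min_sum m (k - 1)) - 2 * min_sum m k) / Suc m"
    by (simp add: min_sum_def sum.distrib sum_subtractf sum_divide_distrib[symmetric] sum_distrib_left)
  finally show ?thesis by (simp add: min_prob_self add_divide_distrib diff_divide_distrib)
qed

lemma record_sum_Suc:
  "record_sum (Suc m) k = record_sum m k + ((if k = 0 then 1 else min_sum m (k - 1)) - min_sum m k) / Suc m"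
proof -
  have "record_sum (Suc m) k = (\<Sum>p=1..m. record_prob (Suc m) p k) + record_prob (Suc m) (Suc m) k"
    by (simp add: record_sum_def)
  also have "(\<Sum>p=1..m. record_prob (Suc m) p k) = (\<Sum>p=1..m. record_prob m p k +
     ((if k = 0 then 0 else min_prob m p (k - 1)) - min_prob m p k) / Suc m)"
    by (intro sum.cong refl record_prob_step)
  also have "\<dots> = record_sum m k + ((if k = 0 then 0 else min_sum m (k - 1)) - min_sum m k) / Suc m"
    by (simp add: record_sum_def min_sum_def sum.distrib sum_subtractf sum_divide_distrib[symmetric])
  finally show ?thesis by (simp add: record_prob_self add_divide_distrib diff_divide_distrib)
qed

section \<open>The error bound\<close>

definition min_dev :: "nat \<Rightarrow> nat \<Rightarrow> real" where
  "min_dev m k = min_sum m k - 1 / 2 ^ (k + 1)"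

text \<open>
  \<open>record_sum - min_sum\<close> accounts for the records that have already been undercut. What is
  subtracted from it is the claimed approximation of \<open>record_sum\<close> minus the limit \<open>1 / 2^(k + 1)\<close> of \<open>min_sum\<close>.
\<close>

definition dead_dev :: "nat \<Rightarrow> nat \<Rightarrow> real" where
  "dead_dev m k = record_sum m k - min_sum m k - harm m / 2 ^ (k + 1) + (real k - 1) / 2 ^ (k + 2) + 1 / 2 ^ (k + 1)"

lemma min_dev_Suc: "min_dev (Suc m) k = min_dev m k + ((if k = 0 then 0 else min_dev m (k - 1)) - 2 * min_dev m k) / Suc m"
proof -
  have "(if k = 0 then 0 else min_dev m (k - 1)) - 2 * min_dev m k =
    (if k = 0 then 1 else min_sum m (k - 1)) - 2 * min_sum m k"
    by (cases k) (simp_all add: min_dev_def)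
  then show ?thesis by (simp only:) (simp add: min_dev_def min_sum_Suc)
qed

text \<open>
  \<open>(m + 1) * min_dev (Suc m) k\<close> is \<open>m - 1\<close> times an old deviation plus one more old deviation,
  so the bound \<open>1 / (2 * m)\<close> propagates because \<open>(m - 1) + 1 = m\<close>.
\<close>

lemma min_dev_bound: "m \<ge> 1 \<Longrightarrow> \<bar>min_dev m k\<bar> \<le> 1 / (2 * real m)"
proof (induction m arbitrary: k rule: dec_induct)
  case base
  have "(1::real) \<le> 2 ^ k" by simp
  then have "(1::real) / 2 ^ (k + 1) \<le> 1 / 2" by (simp add: field_simps)
  moreover have "min_dev 1 k = (if k = 0 then 1 / 2 else - (1 / 2 ^ (k + 1)))"
    using min_sum_Suc[of 0 k] by (auto simp: min_dev_def min_sum_0)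
  ultimately show ?case by auto
next
  case (step m)
  define c where "c = (if k = 0 then 0 else min_dev m (k - 1))"
  have "\<bar>c\<bar> \<le> 1 / (2 * real m)" using step.IH by (auto simp: c_def)
  moreover have "\<bar>(real m - 1) * min_dev m k\<bar> \<le> (real m - 1) * (1 / (2 * real m))"
    unfolding abs_mult using step by (intro mult_mono) auto
  moreover have "(real m - 1) * (1 / (2 * real m)) + 1 / (2 * real m) = 1 / 2"
    using step.hyps by (simp add: field_simps)
  ultimately have "\<bar>(real m - 1) * min_dev m k + c\<bar> \<le> 1 / 2"
    by linarith
  moreover have "(real m + 1) * min_dev (Suc m) k = (real m - 1) * min_dev m k + c"
    using min_dev_Suc[of m k] by (simp add: c_def field_simps)
  ultimately have "\<bar>(real m + 1) * min_dev (Suc m) k\<bar> \<le> 1 / 2" by simp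
  then have "(real m + 1) * \<bar>min_dev (Suc m) k\<bar> \<le> 1 / 2" by (simp only: abs_mult)
  then show ?case by (simp add: field_simps)
qed

text \<open>
  One step adds \<open>min_dev m k / Suc m\<close> to \<open>dead_dev m k\<close>, and \<open>min_dev\<close> itself grows by
  \<open>(min_dev m (k - 1) - 2 * min_dev m k) / Suc m\<close>. The two sides therefore change by the same
  amount in each step, and they agree at \<open>m = 0\<close>.
\<close>

lemma dead_dev_recurrence: "2 * dead_dev m k = (if k = 0 then 0 else dead_dev m (k - 1)) - min_dev m k"
proof (induction m)
  case 0
  show ?case by (cases k) (auto simp: dead_dev_def min_dev_def min_sum_0 record_sum_0 harm_def field_simps)
next
  case (Suc m)
  have D: "dead_dev (Suc m) j = dead_dev m j + min_dev m j / Suc m" for j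
    unfolding dead_dev_def min_dev_def min_sum_Suc record_sum_Suc harm_Suc
    by (simp add: diff_divide_distrib add_divide_distrib inverse_eq_divide mult.commute del: of_nat_Suc)
  show ?case using Suc min_dev_Suc[of m k] unfolding D
    by (cases k) (simp_all add: add_divide_distrib diff_divide_distrib del: of_nat_Suc)
qed

text \<open>
  With \<open>dead_dev_recurrence\<close> the error \<open>dead_dev m k + min_dev m k\<close> is the mean of
  \<open>dead_dev m (k - 1)\<close> and \<open>min_dev m k\<close>. Adding the bounds of the two summands instead would lose a factor 2.
\<close>

lemma record_sum_bound:
  assumes "m \<ge> 1"
  shows "\<bar>record_sum m k - (harm m / 2 ^ (k + 1) - (real k - 1) / 2 ^ (k + 2))\<bar> \<le> 1 / (2 * real m)"
proof -
  have d: "\<bar>dead_dev m j\<bar> \<le> 1 / (2 * real m)" for j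
  proof (induction j)
    case 0
    then show ?case using dead_dev_recurrence[of m 0] min_dev_bound[OF assms, of 0] by simp
  next
    case (Suc j)
    then show ?case using dead_dev_recurrence[of m "Suc j"] min_dev_bound[OF assms, of "Suc j"] by simp
  qed
  have "record_sum m k - (harm m / 2 ^ (k + 1) - (real k - 1) / 2 ^ (k + 2)) = dead_dev m k + min_dev m k"
    by (simp add: dead_dev_def min_dev_def)
  also have "\<dots> = ((if k = 0 then 0 else dead_dev m (k - 1)) + min_dev m k) / 2"
    using dead_dev_recurrence[of m k] by (simp add: field_simps)
  finally have *: "\<bar>record_sum m k - (harm m / 2 ^ (k + 1) - (real k - 1) / 2 ^ (k + 2))\<bar> =
    \<bar>((if k = 0 then 0 else dead_dev m (k - 1)) + min_dev m k) / 2\<bar>" by (simp only:)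
  show ?thesis unfolding * using d[of "k - 1"] min_dev_bound[OF assms, of k] by (cases "k = 0") auto
qed

end

section \<open>From planar points to sequences\<close>

definition pareto_determined :: "nat set \<Rightarrow> ((nat \<Rightarrow> real \<times> real) \<Rightarrow> bool) \<Rightarrow> bool" where
  "pareto_determined I E \<longleftrightarrow> (\<forall>x y.
     (\<forall>i\<in>I. \<forall>j\<in>I. pareto_less (x i) (x j) \<longleftrightarrow> pareto_less (y i) (y j)) \<longrightarrow> E x = E y)"

lemma pareto_determined_K:
  assumes "n \<ge> 1"
  shows "pareto_determined {1..n} (\<lambda>x. Q (K x n))"
proof -
  have "K x n = K y n"
    if "\<forall>i\<in>{1..n}. \<forall>j\<in>{1..n}. pareto_less (x i) (x j) \<longleftrightarrow> pareto_less (y i) (y j)" for x y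
  proof -
    have less: "pareto_less (x i) (x j) \<longleftrightarrow> pareto_less (y i) (y j)" if "1 \<le> i" "i \<le> n" "1 \<le> j" "j \<le> n" for i j
      using that \<open>\<forall>i\<in>{1..n}. _ i\<close> by auto
    have "sets_record x n = sets_record y n"
      using assms unfolding sets_record_def
      by (intro all_cong1 imp_cong refl arg_cong[where f = Not] less) auto
    moreover have "current_record x l j = current_record y l j" if "l \<le> n" for l j
      using that unfolding current_record_def
      by (intro conj_cong ball_cong refl arg_cong[where f = Not] less) auto
    then have "broken_records x n = broken_records y n"
      unfolding broken_records_def by auto
    ultimately show ?thesis by (simp add: K_def)
  qed
  then show ?thesis unfolding pareto_determined_def by metis
qed

text \<open>
  The inverse of the rank function, extended by the identity to a permutation of all indices so
  that \<open>prob_permute\<close> applies.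
\<close>

lemma sorting_permutation:
  assumes "inj_on u {1..n::nat}"
  obtains s where "bij s" "bij_betw s {1..n} {1..n}"
    "\<And>q q'. q \<in> {1..n} \<Longrightarrow> q' \<in> {1..n} \<Longrightarrow> u (s q) < u (s q') \<longleftrightarrow> q < q'"
    "\<And>i. i \<in> {1..n} \<Longrightarrow> s (rank_in {1..n} u i) = i"
proof -
  let ?r = "rank_in {1..n} u"
  have bij: "bij_betw ?r {1..n} {1..n}" using bij_betw_rank_in[OF _ assms] by simp
  define s where "s q = (if q \<in> {1..n} then inv_into {1..n} ?r q else q)" for q
  have sI: "bij_betw s {1..n} {1..n}"
    using bij_betw_inv_into[OF bij] by (subst bij_betw_cong[where g = "inv_into {1..n} ?r"]) (auto simp: s_def)
  have "bij_betw s (- {1..n}) (- {1..n})"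
    by (subst bij_betw_cong[where g = id]) (auto simp: s_def)
  from bij_betw_combine[OF sI this] have "bij s" by simp
  moreover have rs: "?r (s q) = q" if "q \<in> {1..n}" for q
    using bij_betw_inv_into_right[OF bij that] that by (simp add: s_def)
  have "u (s q) < u (s q') \<longleftrightarrow> q < q'" if "q \<in> {1..n}" "q' \<in> {1..n}" for q q'
    using rank_in_less_iff[of "{1..n}" "s q" "s q'" u] rs that bij_betwE[OF sI] by auto
  moreover have "s (?r i) = i" if "i \<in> {1..n}" for i
    using bij_betw_inv_into_left[OF bij that] bij_betwE[OF bij] that by (simp add: s_def)
  ultimately show ?thesis using sI that by blast
qed

text \<open>
  A record current at time \<open>n - 1\<close> can only be lost through the point \<open>n\<close>.
\<close>

lemma broken_records_eq:
  assumes "n \<ge> 1"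
  shows "broken_records x n = {j\<in>{1..n} - {n}. pareto_less (x n) (x j) \<and>
    (\<forall>i\<in>{1..n} - {n}. \<not> pareto_less (x i) (x j))}"
proof -
  have I: "{1..n} = insert n {1..n - 1}" "{1..n} - {n} = {1..n - 1}" using assms by auto
  show ?thesis unfolding I(2) broken_records_def current_record_def
    by (subst (2) I(1)) (use assms in auto)
qed

context
  fixes u v :: "nat \<Rightarrow> real" and s :: "nat \<Rightarrow> nat" and n p :: nat
  assumes v: "inj_on v {1..n}"
    and s: "bij_betw s {1..n} {1..n}"
    and sorted: "\<And>q q'. q \<in> {1..n} \<Longrightarrow> q' \<in> {1..n} \<Longrightarrow> u (s q) < u (s q') \<longleftrightarrow> q < q'"
    and p: "p \<in> {1..n}" "s p = n"
begin

private lemma image_s: "s ` {1..n} = {1..n}" "s ` ({1..n} - {p}) = {1..n} - {n}"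
proof -
  show "s ` {1..n} = {1..n}" using s by (simp add: bij_betw_def)
  then show "s ` ({1..n} - {p}) = {1..n} - {n}"
    using s p by (subst inj_on_image_set_diff[of s "{1..n}"]) (auto simp: bij_betw_def)
qed

private lemma less_or_gr:
  assumes "q \<in> {1..n}" "q' \<in> {1..n}" "q \<noteq> q'"
  shows "\<not> v (s q) < v (s q') \<longleftrightarrow> v (s q') < v (s q)"
proof -
  have "s q \<noteq> s q'" using assms s by (auto simp: bij_betw_def dest: inj_onD)
  moreover have "s q \<in> {1..n}" "s q' \<in> {1..n}" using assms bij_betwE[OF s] by auto
  ultimately have "v (s q) \<noteq> v (s q')" using v by (auto dest: inj_onD)
  then show ?thesis by linarith
qed

lemma sets_record_iff_min_upto:
  "sets_record (\<lambda>i. (u i, v i)) n \<longleftrightarrow> min_upto p p (v \<circ> s)"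
proof -
  have "sets_record (\<lambda>i. (u i, v i)) n \<longleftrightarrow> (\<forall>i\<in>{1..n} - {n}. \<not> (u i < u n \<and> v i < v n))"
    by (auto simp: sets_record_def pareto_less_def)
  also have "\<dots> \<longleftrightarrow> (\<forall>q\<in>{1..n} - {p}. \<not> (u (s q) < u (s p) \<and> v (s q) < v (s p)))"
    unfolding image_s(2)[symmetric] by (simp add: p)
  also have "\<dots> \<longleftrightarrow> (\<forall>q\<in>{1..n} - {p}. q < p \<longrightarrow> v (s p) < v (s q))"
    using p sorted less_or_gr[OF _ p(1)] by (intro ball_cong refl) auto
  also have "\<dots> \<longleftrightarrow> min_upto p p (v \<circ> s)"
  proof -
    have "{1..p} - {p} = {q\<in>{1..n} - {p}. q < p}" using p by auto
    then show ?thesis unfolding min_upto_def by (simp only: Ball_def mem_Collect_eq comp_def) blast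
  qed
  finally show ?thesis .
qed

lemma card_broken_records_eq_killed:
  "card (broken_records (\<lambda>i. (u i, v i)) n) = card (killed n p (v \<circ> s))"
proof -
  have "broken_records (\<lambda>i. (u i, v i)) n = {j\<in>s ` ({1..n} - {p}). (u (s p) < u j \<and> v (s p) < v j) \<and>
    (\<forall>i\<in>s ` ({1..n} - {p}). \<not> (u i < u j \<and> v i < v j))}"
    using p(1) unfolding image_s(2) p(2) by (subst broken_records_eq) (simp_all add: pareto_less_def)
  also have "\<dots> = s ` {q\<in>{1..n} - {p}. (u (s p) < u (s q) \<and> v (s p) < v (s q)) \<and>
    (\<forall>q'\<in>{1..n} - {p}. \<not> (u (s q') < u (s q) \<and> v (s q') < v (s q)))}"
    by blast
  also have "{q\<in>{1..n} - {p}. (u (s p) < u (s q) \<and> v (s p) < v (s q)) \<and>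
    (\<forall>q'\<in>{1..n} - {p}. \<not> (u (s q') < u (s q) \<and> v (s q') < v (s q)))} =
    {q\<in>{1..n} - {p}. (p < q \<and> v (s p) < v (s q)) \<and>
    (\<forall>q'\<in>{1..n} - {p}. q' < q \<longrightarrow> v (s q) < v (s q'))}"
    using p sorted less_or_gr by (intro Collect_cong conj_cong ball_cong refl) auto
  also have "\<dots> = killed n p (v \<circ> s)"
    using p by (auto simp: killed_def)
  finally have "broken_records (\<lambda>i. (u i, v i)) n = s ` killed n p (v \<circ> s)" .
  moreover have "killed n p (v \<circ> s) \<subseteq> {1..n}" by (auto simp: killed_def)
  then have "inj_on s (killed n p (v \<circ> s))"
    using s unfolding bij_betw_def by (blast intro: inj_on_subset)
  ultimately show ?thesis by (simp add: card_image)
qed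

lemma K_eq_iff:
  "K (\<lambda>i. (u i, v i)) n = int k \<longleftrightarrow> min_upto p p (v \<circ> s) \<and> card (killed n p (v \<circ> s)) = k"
  unfolding K_def sets_record_iff_min_upto card_broken_records_eq_killed by auto

lemma K_nonneg_iff: "K (\<lambda>i. (u i, v i)) n \<ge> 0 \<longleftrightarrow> min_upto p p (v \<circ> s)"
  unfolding K_def sets_record_iff_min_upto by auto

end

context atomless_prob
begin

section \<open>The law of the number of broken records\<close>

sublocale PP: pair_prob_space P P
  by unfold_locales

lemma pareto_determined_pred:
  assumes "finite I" "pareto_determined I E"
  shows "Measurable.pred (P \<Otimes>\<^sub>M P) (\<lambda>(u, v). E (\<lambda>i. (u i, v i)))"
proof (rule pred_of_finitely_many_preds[where J = "I \<times> I"
    and q = "\<lambda>(i, j) (u, v). pareto_less (u i, v i) (u j, v j)"])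
  show "finite (I \<times> I)" using assms by simp
  show "Measurable.pred (P \<Otimes>\<^sub>M P) ((\<lambda>(i, j) (u, v). pareto_less (u i, v i) (u j, v j)) ij)" for ij
    by (cases ij) (simp add: pareto_less_def case_prod_beta)
  fix x y :: "(nat \<Rightarrow> real) \<times> (nat \<Rightarrow> real)"
  assume *: "\<And>ij. ij \<in> I \<times> I \<Longrightarrow> (case ij of (i, j) \<Rightarrow> \<lambda>(u, v). pareto_less (u i, v i) (u j, v j)) x =
    (case ij of (i, j) \<Rightarrow> \<lambda>(u, v). pareto_less (u i, v i) (u j, v j)) y"
  have "\<forall>i\<in>I. \<forall>j\<in>I. pareto_less (fst x i, snd x i) (fst x j, snd x j) \<longleftrightarrow>
      pareto_less (fst y i, snd y i) (fst y j, snd y j)"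
  proof (intro ballI)
    fix i j assume "i \<in> I" "j \<in> I"
    then show "pareto_less (fst x i, snd x i) (fst x j, snd x j) \<longleftrightarrow>
      pareto_less (fst y i, snd y i) (fst y j, snd y j)"
      using *[of "(i, j)"] by (simp add: case_prod_beta)
  qed
  then show "(case x of (u, v) \<Rightarrow> E (\<lambda>i. (u i, v i))) = (case y of (u, v) \<Rightarrow> E (\<lambda>i. (u i, v i)))"
    using assms(2) unfolding pareto_determined_def case_prod_beta
    by (elim allE[of _ "\<lambda>i. (fst x i, snd x i)"] allE[of _ "\<lambda>i. (fst y i, snd y i)"]) auto
qed

lemma pareto_determined_order_determined:
  "pareto_determined I E \<Longrightarrow> order_determined I (\<lambda>v. E (\<lambda>i. (u i, v i)))"
  unfolding pareto_determined_def order_determined_def same_order_def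
  by (intro allI impI) (auto simp: pareto_less_def)

lemma prob_rank_in_last:
  assumes "r \<in> {1..n}"
  shows "P.prob {v. rank_in {1..n} v n = r} = 1 / n"
proof -
  obtain l where l: "n = Suc l" using assms by (cases n) auto
  have "P.prob {v. True \<and> rank_in {1..n} v n = r} = P.prob {v. True} / Suc (card {1..l})"
    using prob_rank_in[OF _ _ order_determined_True, of "{1..l}" n r] assms
    unfolding l atLeastAtMost_insert_Suc[symmetric] by simp
  also have "P.prob {v. True} = 1" using P.P.prob_space by simp
  finally show ?thesis using l by simp
qed

text \<open>
  Conditioning on the first coordinates \<open>u\<close>: if the conditional probability of \<open>E\<close> depends on \<open>u\<close> only
  through the rank of the last point, which is uniform, it is averaged over the ranks.
\<close>

lemma prob_pair_given_rank_in:
  assumes "n \<ge> 1" and E: "Measurable.pred (P \<Otimes>\<^sub>M P) E" and g: "\<And>p. g p \<ge> 0"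
    and cond: "\<And>u. inj_on u {1..n} \<Longrightarrow> P.prob {v. E (u, v)} = g (rank_in {1..n} u n)"
  shows "measure (P \<Otimes>\<^sub>M P) {z. E z} = (\<Sum>p=1..n. g p) / n"
proof -
  have meas: "{u. rank_in {1..n} u n = p} \<in> sets P" for p
    using order_determined_pred[OF _ order_determined_rank_in[of n "{1..n}" "\<lambda>r. r = p"]] assms(1)
    by (simp add: pred_def)
  have "{z. E z} \<in> sets (P \<Otimes>\<^sub>M P)" using E by (simp add: pred_def space_pair_measure)
  then have "emeasure (P \<Otimes>\<^sub>M P) {z. E z} = (\<integral>\<^sup>+u. emeasure P (Pair u -` {z. E z}) \<partial>P)"
    by (rule P.P.emeasure_pair_measure_alt)
  also have "\<dots> = (\<integral>\<^sup>+u. (\<Sum>p=1..n. ennreal (g p) * indicator {u. rank_in {1..n} u n = p} u) \<partial>P)"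
  proof (rule nn_integral_cong_AE)
    have "AE u in P. inj_on u {1..n}" by (rule AE_inj_on) simp
    then show "AE u in P. emeasure P (Pair u -` {z. E z}) =
      (\<Sum>p=1..n. ennreal (g p) * indicator {u. rank_in {1..n} u n = p} u)"
    proof eventually_elim
      case (elim u)
      have "rank_in {1..n} u n \<in> {1..n}" using rank_in_bounds[of "{1..n}" n u] assms(1) by simp
      then have "(\<Sum>p=1..n. ennreal (g p) * indicator {u. rank_in {1..n} u n = p} u) = ennreal (g (rank_in {1..n} u n))"
        by (simp add: indicator_def if_distrib[of "\<lambda>x. _ * x"] sum.delta cong: if_cong)
      also have "\<dots> = emeasure P {v. E (u, v)}"
        using cond[OF elim] by (simp add: P.P.emeasure_eq_measure)
      finally show ?case by (simp add: vimage_def)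
    qed
  qed
  also have "\<dots> = (\<Sum>p=1..n. ennreal (g p) * emeasure P {u. rank_in {1..n} u n = p})"
    by (intro trans[OF nn_integral_sum] sum.cong refl nn_integral_cmult_indicator meas
        borel_measurable_times_ennreal borel_measurable_const borel_measurable_indicator)
  also have "\<dots> = (\<Sum>p=1..n. ennreal (g p * (1 / n)))"
  proof (intro sum.cong refl)
    fix p assume "p \<in> {1..n}"
    then show "ennreal (g p) * emeasure P {u. rank_in {1..n} u n = p} = ennreal (g p * (1 / n))"
      unfolding P.P.emeasure_eq_measure prob_rank_in_last[OF \<open>p \<in> {1..n}\<close>] using g by (intro ennreal_mult[symmetric]) auto
  qed
  also have "\<dots> = ennreal ((\<Sum>p=1..n. g p) / n)"
    using g by (subst sum_ennreal) (auto simp: sum_divide_distrib)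
  finally show ?thesis using g by (simp add: measure_def sum_nonneg)
qed

lemma prob_min_upto_killed_permute:
  assumes "bij s" "p \<in> {1..n}"
  shows "P.prob {v. min_upto p p (v \<circ> s) \<and> card (killed n p (v \<circ> s)) = k} = record_prob n p k"
    and "P.prob {v. min_upto p p (v \<circ> s)} = 1 / p"
proof -
  have od: "order_determined {1..n} (\<lambda>v. min_upto p p v \<and> card (killed n p v) = k)"
    "order_determined {1..n} (min_upto p p)"
    using assms by (intro order_determined_conj order_determined_min_upto order_determined_killed; simp)+
  show "P.prob {v. min_upto p p (v \<circ> s) \<and> card (killed n p (v \<circ> s)) = k} = record_prob n p k"
    and "P.prob {v. min_upto p p (v \<circ> s)} = 1 / p"
    using prob_permute[OF assms(1) order_determined_pred[OF _ od(1)]]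
      prob_permute[OF assms(1) order_determined_pred[OF _ od(2)]] prob_min_upto[of p] assms(2)
    by (auto simp: record_prob_def)
qed

text \<open>
  For fixed \<open>u\<close>, rearranging the second coordinates by the sorting permutation of \<open>u\<close> does not
  change their law.
\<close>

lemma prob_given_first_coordinates:
  assumes u: "inj_on u {1..n}" and "n \<ge> 1"
  defines "p \<equiv> rank_in {1..n} u n"
  shows "P.prob {v. K (\<lambda>i. (u i, v i)) n = int k} = record_prob n p k"
    and "P.prob {v. K (\<lambda>i. (u i, v i)) n \<ge> 0} = 1 / p"
proof -
  obtain s where s: "bij s" "bij_betw s {1..n} {1..n}"
    "\<And>q q'. q \<in> {1..n} \<Longrightarrow> q' \<in> {1..n} \<Longrightarrow> u (s q) < u (s q') \<longleftrightarrow> q < q'"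
    "\<And>i. i \<in> {1..n} \<Longrightarrow> s (rank_in {1..n} u i) = i"
    using sorting_permutation[OF u] by blast
  have p: "p \<in> {1..n}" "s p = n"
    using rank_in_bounds[of "{1..n}" n u] s(4) \<open>n \<ge> 1\<close> by (auto simp: p_def)
  have inj: "AE v in P. inj_on v {1..n}" by (rule AE_inj_on) simp
  have m [measurable]: "Measurable.pred P (\<lambda>v. Q (K (\<lambda>i. (u i, v i)) n))" for Q
    by (rule order_determined_pred[OF _ pareto_determined_order_determined[OF pareto_determined_K[OF \<open>n \<ge> 1\<close>]]]) simp
  have ms: "(\<lambda>v. v \<circ> s) \<in> P \<rightarrow>\<^sub>M P"
    unfolding comp_def by (rule measurable_PiM_single') auto
  have m2 [measurable]: "Measurable.pred P (\<lambda>v. min_upto p p (v \<circ> s))"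
    "Measurable.pred P (\<lambda>v. card (killed n p (v \<circ> s)) = k)"
    by (rule measurable_compose[OF ms order_determined_pred[of "{1..n}"]];
        use p in \<open>auto intro!: order_determined_min_upto order_determined_killed simp del: One_nat_def\<close>)+
  have m3: "Measurable.pred P (\<lambda>v. min_upto p p (v \<circ> s) \<and> card (killed n p (v \<circ> s)) = k)"
    using m2 by (rule pred_intros_logic)
  have "P.prob {v. K (\<lambda>i. (u i, v i)) n = int k} =
     P.prob {v. min_upto p p (v \<circ> s) \<and> card (killed n p (v \<circ> s)) = k}"
  proof (rule P.finite_measure_eq_AE)
    show "AE v in P. v \<in> {v. K (\<lambda>i. (u i, v i)) n = int k} \<longleftrightarrow>
       v \<in> {v. min_upto p p (v \<circ> s) \<and> card (killed n p (v \<circ> s)) = k}"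
      using inj by eventually_elim (use K_eq_iff[OF _ s(2,3) p] in auto)
  qed (use m[of "\<lambda>x. x = int k"] m3 in \<open>auto simp: pred_def\<close>)
  then show "P.prob {v. K (\<lambda>i. (u i, v i)) n = int k} = record_prob n p k"
    using prob_min_upto_killed_permute(1)[OF s(1) p(1)] by simp
  have "P.prob {v. K (\<lambda>i. (u i, v i)) n \<ge> 0} = P.prob {v. min_upto p p (v \<circ> s)}"
  proof (rule P.finite_measure_eq_AE)
    show "AE v in P. v \<in> {v. K (\<lambda>i. (u i, v i)) n \<ge> 0} \<longleftrightarrow> v \<in> {v. min_upto p p (v \<circ> s)}"
      using inj by eventually_elim (use K_nonneg_iff[OF _ s(2,3) p] in auto)
  qed (use m[of "\<lambda>x. x \<ge> 0"] m2 in \<open>auto simp: pred_def\<close>)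
  then show "P.prob {v. K (\<lambda>i. (u i, v i)) n \<ge> 0} = 1 / p"
    using prob_min_upto_killed_permute(2)[OF s(1) p(1)] by simp
qed

lemma prob_K_pair:
  assumes "n \<ge> 1"
  shows "measure (P \<Otimes>\<^sub>M P) {(u, v). K (\<lambda>i. (u i, v i)) n = int k} = record_sum n k / n"
    and "measure (P \<Otimes>\<^sub>M P) {(u, v). K (\<lambda>i. (u i, v i)) n \<ge> 0} = harm n / n"
proof -
  have m: "Measurable.pred (P \<Otimes>\<^sub>M P) (\<lambda>(u, v). Q (K (\<lambda>i. (u i, v i)) n))" for Q
    by (rule pareto_determined_pred[OF _ pareto_determined_K[OF assms], of Q]) simp
  show "measure (P \<Otimes>\<^sub>M P) {(u, v). K (\<lambda>i. (u i, v i)) n = int k} = record_sum n k / n"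
    using prob_pair_given_rank_in[OF assms m[of "\<lambda>x. x = int k"], of "\<lambda>p. record_prob n p k"]
      prob_given_first_coordinates(1)[OF _ assms] by (simp add: record_sum_def record_prob_def)
  show "measure (P \<Otimes>\<^sub>M P) {(u, v). K (\<lambda>i. (u i, v i)) n \<ge> 0} = harm n / n"
    using prob_pair_given_rank_in[OF assms m[of "\<lambda>x. x \<ge> 0"], of "\<lambda>p. 1 / p"]
      prob_given_first_coordinates(2)[OF _ assms] by (simp add: harm_def inverse_eq_divide)
qed

text \<open>
  A sequence of independent points with independent coordinates is the same as a pair of independent
  sequences. The two measures agree on rectangles \<open>Pi\<^sub>E I A\<close> by Fubini, even though the sets \<open>A i\<close>
  are not products themselves: after fixing \<open>u\<close> the sections factorise over \<open>i\<close>, and so does the integral over \<open>u\<close>.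
\<close>

lemma distr_pair_eq_PiM:
  assumes [simp]: "finite I"
  shows "distr (P \<Otimes>\<^sub>M P) (Pi\<^sub>M I (\<lambda>_. N \<Otimes>\<^sub>M N)) (\<lambda>(u, v). \<lambda>i\<in>I. (u i, v i)) = Pi\<^sub>M I (\<lambda>_. N \<Otimes>\<^sub>M N)"
    (is "distr _ ?Q ?f = _")
proof -
  interpret NN: pair_prob_space N N by unfold_locales
  interpret Q: product_prob_space "\<lambda>_::nat. N \<Otimes>\<^sub>M N" I by unfold_locales
  have f: "?f \<in> P \<Otimes>\<^sub>M P \<rightarrow>\<^sub>M ?Q"
    unfolding case_prod_beta by (intro measurable_restrict) measurable
  show ?thesis
  proof (rule Q.PiM_eqI)
    fix A :: "nat \<Rightarrow> (real \<times> real) set" assume A: "\<And>i. i \<in> I \<Longrightarrow> A i \<in> sets (N \<Otimes>\<^sub>M N)"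
    have APi: "Pi\<^sub>E I A \<in> sets ?Q" using A by (intro sets_PiM_I_finite) auto
    have sec: "Pair a -` A i \<in> sets N" if "i \<in> I" for i a
      using sets_Pair1[OF A[OF that]] .
    have secm: "(\<lambda>a. emeasure N (Pair a -` A i)) \<in> borel_measurable N" if "i \<in> I" for i
      using measurable_emeasure_Pair[OF A[OF that]] .
    have "emeasure (distr (P \<Otimes>\<^sub>M P) ?Q ?f) (Pi\<^sub>E I A) = emeasure (P \<Otimes>\<^sub>M P) (?f -` Pi\<^sub>E I A \<inter> space (P \<Otimes>\<^sub>M P))"
      using f APi by (rule emeasure_distr)
    also have "\<dots> = (\<integral>\<^sup>+u. emeasure P (Pair u -` (?f -` Pi\<^sub>E I A \<inter> space (P \<Otimes>\<^sub>M P))) \<partial>P)"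
      using measurable_sets[OF f APi] by (rule P.P.emeasure_pair_measure_alt)
    also have "\<dots> = (\<integral>\<^sup>+u. (\<Prod>i\<in>I. emeasure N (Pair (u i) -` A i)) \<partial>P)"
    proof (rule nn_integral_cong)
      fix u
      have "Pair u -` (?f -` Pi\<^sub>E I A \<inter> space (P \<Otimes>\<^sub>M P)) = {v\<in>space P. \<forall>i\<in>I. v i \<in> Pair (u i) -` A i}"
        by (auto simp: space_pair_measure PiE_def Pi_def)
      then show "emeasure P (Pair u -` (?f -` Pi\<^sub>E I A \<inter> space (P \<Otimes>\<^sub>M P))) =
          (\<Prod>i\<in>I. emeasure N (Pair (u i) -` A i))"
        using P.emeasure_PiM_Collect[of I "\<lambda>i. Pair (u i) -` A i"] sec by simp
    qed
    also have "\<dots> = (\<integral>\<^sup>+u. (\<Prod>i\<in>I. emeasure N (Pair (u i) -` A i)) \<partial>distr P (Pi\<^sub>M I (\<lambda>_. N)) (\<lambda>u. restrict u I))"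
      using secm by (subst nn_integral_distr) (auto intro!: nn_integral_cong prod.cong borel_measurable_prod_ennreal
           measurable_compose[OF measurable_component_singleton] measurable_restrict)
    also have "distr P (Pi\<^sub>M I (\<lambda>_. N)) (\<lambda>u. restrict u I) = Pi\<^sub>M I (\<lambda>_. N)"
      by (rule P.distr_PiM_restrict_finite) auto
    also have "(\<integral>\<^sup>+u. (\<Prod>i\<in>I. emeasure N (Pair (u i) -` A i)) \<partial>Pi\<^sub>M I (\<lambda>_. N)) =
      (\<Prod>i\<in>I. \<integral>\<^sup>+a. emeasure N (Pair a -` A i) \<partial>N)"
      using secm by (intro P.product_nn_integral_prod) auto
    also have "\<dots> = (\<Prod>i\<in>I. emeasure (N \<Otimes>\<^sub>M N) (A i))"
      using A by (intro prod.cong refl emeasure_pair_measure_alt[symmetric]) auto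
    finally show "emeasure (distr (P \<Otimes>\<^sub>M P) ?Q ?f) (Pi\<^sub>E I A) = (\<Prod>i\<in>I. emeasure (N \<Otimes>\<^sub>M N) (A i))" .
  qed simp_all
qed

end

section \<open>Transfer to the given random points\<close>

lemma uniform_unit_square:
  defines "U \<equiv> uniform_measure lborel {0<..<1::real}"
  shows "U \<Otimes>\<^sub>M U = uniform_measure lborel ({0<..<1} \<times> {0<..<1})"
proof (rule pair_measure_eqI)
  have "prob_space U" unfolding U_def by (rule prob_space_uniform_measure) auto
  then show "sigma_finite_measure U" "sigma_finite_measure U"
    by (simp_all add: prob_space_imp_sigma_finite)
  show "sets (U \<Otimes>\<^sub>M U) = sets (uniform_measure lborel ({0<..<1::real} \<times> {0<..<1::real}))"
    unfolding U_def by (simp add: borel_prod[symmetric] cong: sets_pair_measure_cong)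
  fix A B :: "real set" assume "A \<in> sets U" "B \<in> sets U"
  then have [measurable]: "A \<in> sets borel" "B \<in> sets borel" by (auto simp: U_def)
  have lb: "emeasure lborel (C \<times> D) = emeasure lborel C * emeasure lborel D"
    if "C \<in> sets borel" "D \<in> sets borel" for C D :: "real set"
    using that unfolding lborel_prod[symmetric] by (intro lborel.emeasure_pair_measure_Times) auto
  have "emeasure (uniform_measure lborel ({0<..<1} \<times> {0<..<1})) (A \<times> B) =
    emeasure lborel (({0<..<1} \<inter> A) \<times> ({0<..<1} \<inter> B)) / emeasure lborel ({0<..<1::real} \<times> {0<..<1::real})"
    by (subst emeasure_uniform_measure) (auto simp: Times_Int_Times borel_Times)
  also have "\<dots> = emeasure U A * emeasure U B"
    by (simp add: lb U_def emeasure_uniform_measure divide_ennreal_def)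
  finally show "emeasure U A * emeasure U B = emeasure (uniform_measure lborel ({0<..<1} \<times> {0<..<1})) (A \<times> B)"
    by simp
qed

lemma atomless_prob_uniform: "atomless_prob (uniform_measure lborel {0<..<1::real})"
proof -
  interpret prob_space "uniform_measure lborel {0<..<1::real}"
    by (rule prob_space_uniform_measure) auto
  show ?thesis
  proof
    show "emeasure (uniform_measure lborel {0<..<1::real}) {x} = 0" for x
    proof (subst emeasure_uniform_measure)
      have "emeasure lborel ({0<..<1} \<inter> {x}) \<le> emeasure lborel {x}" by (intro emeasure_mono) auto
      then show "emeasure lborel ({0<..<1} \<inter> {x}) / emeasure lborel {0<..<1::real} = 0" by simp
    qed auto
  qed simp
qed

lemma (in atomless_prob) prob_transfer:
  fixes M :: "'a measure" and X :: "nat \<Rightarrow> 'a \<Rightarrow> real \<times> real"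
  assumes "prob_space M" and indep: "prob_space.indep_vars M (\<lambda>_. borel) X {1..}"
    and law: "\<And>i. i \<ge> 1 \<Longrightarrow> distr M borel (X i) = N \<Otimes>\<^sub>M N"
    and "n \<ge> 1" and E: "pareto_determined {1..n} E"
  shows "measure M {\<omega>\<in>space M. E (\<lambda>i. X i \<omega>)} = measure (P \<Otimes>\<^sub>M P) {(u, v). E (\<lambda>i. (u i, v i))}"
proof -
  interpret M: prob_space M by fact
  let ?Q = "Pi\<^sub>M {1..n} (\<lambda>_. N \<Otimes>\<^sub>M N)"
  have sets_NN: "sets (N \<Otimes>\<^sub>M N) = sets borel"
    by (simp add: borel_prod[symmetric] cong: sets_pair_measure_cong)
  have rv [measurable]: "X i \<in> borel_measurable M" if "i \<in> {1..n}" for i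
    using indep that by (auto simp: M.indep_vars_def2)
  have indep_n: "M.indep_vars (\<lambda>_. borel) X {1..n}"
    by (rule M.indep_vars_subset[OF indep]) auto
  have "distr M (Pi\<^sub>M {1..n} (\<lambda>_. borel)) (\<lambda>\<omega>. \<lambda>i\<in>{1..n}. X i \<omega>) = Pi\<^sub>M {1..n} (\<lambda>i. distr M borel (X i))"
    by (rule M.indep_vars_iff_distr_eq_PiM'[THEN iffD1, OF _ _ indep_n]) (use rv \<open>n \<ge> 1\<close> in auto)
  also have "\<dots> = ?Q" by (intro PiM_cong refl law) auto
  also have "distr M (Pi\<^sub>M {1..n} (\<lambda>_. borel)) (\<lambda>\<omega>. \<lambda>i\<in>{1..n}. X i \<omega>) =
      distr M ?Q (\<lambda>\<omega>. \<lambda>i\<in>{1..n}. X i \<omega>)"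
    by (intro distr_cong refl sets_PiM_cong sets_NN[symmetric])
  finally have X: "distr M ?Q (\<lambda>\<omega>. \<lambda>i\<in>{1..n}. X i \<omega>) = ?Q" .
  have Xm: "(\<lambda>\<omega>. \<lambda>i\<in>{1..n}. X i \<omega>) \<in> M \<rightarrow>\<^sub>M ?Q"
    using rv unfolding measurable_cong_sets[OF refl sets_NN, symmetric] by (rule measurable_restrict)
  have f: "(\<lambda>(u, v). \<lambda>i\<in>{1..n}. (u i, v i)) \<in> P \<Otimes>\<^sub>M P \<rightarrow>\<^sub>M ?Q"
    unfolding case_prod_beta by (intro measurable_restrict) measurable
  have restr: "E (\<lambda>i\<in>{1..n}. x i) = E x" for x
    using E unfolding pareto_determined_def by auto
  have "Measurable.pred ?Q E"
  proof (rule pred_of_finitely_many_preds[where J = "{1..n} \<times> {1..n}"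
        and q = "\<lambda>(i, j) x. pareto_less (x i) (x j)"])
    show "Measurable.pred ?Q ((\<lambda>(i, j) x. pareto_less (x i) (x j)) ij)" if "ij \<in> {1..n} \<times> {1..n}" for ij
      using that by (cases ij) (simp add: pareto_less_def)
    fix x y :: "nat \<Rightarrow> real \<times> real"
    assume *: "\<And>ij. ij \<in> {1..n} \<times> {1..n} \<Longrightarrow> (case ij of (i, j) \<Rightarrow> \<lambda>x. pareto_less (x i) (x j)) x =
      (case ij of (i, j) \<Rightarrow> \<lambda>x. pareto_less (x i) (x j)) y"
    have "\<forall>i\<in>{1..n}. \<forall>j\<in>{1..n}. pareto_less (x i) (x j) \<longleftrightarrow> pareto_less (y i) (y j)"
      using *[of "(i, j)" for i j] by simp
    then show "E x = E y" using E unfolding pareto_determined_def by (elim allE impE)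
  qed simp
  then have Em: "{x\<in>space ?Q. E x} \<in> sets ?Q" by (simp add: pred_def)
  have "measure M {\<omega>\<in>space M. E (\<lambda>i. X i \<omega>)} =
    measure (distr M ?Q (\<lambda>\<omega>. \<lambda>i\<in>{1..n}. X i \<omega>)) {x\<in>space ?Q. E x}"
  proof (subst measure_distr[OF Xm Em], rule arg_cong[where f = "measure M"])
    show "{\<omega>\<in>space M. E (\<lambda>i. X i \<omega>)} = (\<lambda>\<omega>. \<lambda>i\<in>{1..n}. X i \<omega>) -` {x\<in>space ?Q. E x} \<inter> space M"
      using measurable_space[OF Xm] restr by blast
  qed
  also have "\<dots> = measure (distr (P \<Otimes>\<^sub>M P) ?Q (\<lambda>(u, v). \<lambda>i\<in>{1..n}. (u i, v i))) {x\<in>space ?Q. E x}"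
    unfolding X by (subst distr_pair_eq_PiM) auto
  also have "\<dots> = measure (P \<Otimes>\<^sub>M P) {(u, v). E (\<lambda>i. (u i, v i))}"
  proof (subst measure_distr[OF f Em], rule arg_cong[where f = "measure (P \<Otimes>\<^sub>M P)"])
    have "(\<lambda>i\<in>{1..n}. (u i, v i)) \<in> space ?Q" for u v :: "nat \<Rightarrow> real"
      using measurable_space[OF f, of "(u, v)"] by (simp add: space_pair_measure)
    then show "(\<lambda>(u, v). \<lambda>i\<in>{1..n}. (u i, v i)) -` {x\<in>space ?Q. E x} \<inter> space (P \<Otimes>\<^sub>M P) =
        {(u, v). E (\<lambda>i. (u i, v i))}"
      by (auto simp: restr space_pair_measure simp del: One_nat_def)
  qed
  finally show ?thesis .
qed

theorem mainTheorem3: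
  fixes M :: "'a measure" and X :: "nat \<Rightarrow> 'a \<Rightarrow> real \<times> real" and n k :: nat
  assumes "prob_space M"
    and "prob_space.indep_vars M (\<lambda>_. borel) X {1..}"
    and "\<And>i. i \<ge> 1 \<Longrightarrow>
      distr M borel (X i) = uniform_measure lborel ({0<..<1} \<times> {0<..<1})"
    and "n \<ge> 1"
  shows "\<bar>cond_prob M (\<lambda>\<omega>. K (\<lambda>i. X i \<omega>) n = int k) (\<lambda>\<omega>. K (\<lambda>i. X i \<omega>) n \<ge> 0)
      - (1 / 2 ^ (k + 1) + alpha n k)\<bar> \<le> 1 / 2 * inverse (real n) * inverse (harm n)"
proof -
  interpret U: atomless_prob "uniform_measure lborel {0<..<1::real}"
    by (rule atomless_prob_uniform)
  note transfer = U.prob_transfer[OF assms(1,2) assms(3)[folded uniform_unit_square] assms(4)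
      pareto_determined_K[OF assms(4)]]
  have H: "harm n > (0::real)" using assms(4) by (intro harm_pos) auto
  have "measure M {\<omega>\<in>space M. K (\<lambda>i. X i \<omega>) n = int k} = U.record_sum n k / n"
    using transfer[of "\<lambda>x. x = int k"] U.prob_K_pair(1)[OF assms(4)] by simp
  moreover have "measure M {\<omega>\<in>space M. K (\<lambda>i. X i \<omega>) n \<ge> 0} = harm n / n"
    using transfer[of "\<lambda>x. x \<ge> 0"] U.prob_K_pair(2)[OF assms(4)] by simp
  moreover have "{\<omega>\<in>space M. K (\<lambda>i. X i \<omega>) n = int k \<and> K (\<lambda>i. X i \<omega>) n \<ge> 0} =
      {\<omega>\<in>space M. K (\<lambda>i. X i \<omega>) n = int k}"
    by auto
  ultimately have cond: "cond_prob M (\<lambda>\<omega>. K (\<lambda>i. X i \<omega>) n = int k) (\<lambda>\<omega>. K (\<lambda>i. X i \<omega>) n \<ge> 0) =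
      U.record_sum n k / harm n"
    using assms(4) by (simp add: cond_prob_def)
  have diff: "U.record_sum n k / harm n - (1 / 2 ^ (k + 1) + alpha n k) =
      (U.record_sum n k - (harm n / 2 ^ (k + 1) - (real k - 1) / 2 ^ (k + 2))) * inverse (harm n)"
  proof -
    have "R / h - (1 / a + - c * (1 / b) * inverse h) = (R - (h / a - c / b)) * inverse h"
      if "h \<noteq> 0" "a \<noteq> 0" "b \<noteq> 0" for R h a b c :: real
      using that by (simp add: field_simps)
    from this[of "harm n" "2 ^ (k + 1)" "2 ^ (k + 2)" "U.record_sum n k" "real k - 1"] show ?thesis
      using H unfolding alpha_def by simp
  qed
  have H': "0 \<le> inverse (harm n :: real)" using H by (rule less_imp_le[OF positive_imp_inverse_positive])
  have "\<bar>(U.record_sum n k - (harm n / 2 ^ (k + 1) - (real k - 1) / 2 ^ (k + 2))) * inverse (harm n)\<bar> \<le> 1 / (2 * real n) * inverse (harm n)"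
    using mult_right_mono[OF U.record_sum_bound[OF assms(4), of k] H'] unfolding abs_mult_pos[OF H'] .
  then show ?thesis unfolding cond diff by (simp only: inverse_eq_divide times_divide_times_eq mult_1)
qed

end
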